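(* Let $H$ be a real Hilbert space and let $F=f+g$, where $f:H\to\mathbb{R}$ is convex and $L$-smooth with $L>0$, and $g:H\to\mathbb{R}\cup\{\infty\}$ is convex, proper and lower-semicontinuous. Assume $\operatorname{argmin}(F)\neq\emptyset$. Let $s\in(0,1/L]$ and $\gamma\in(0,2-sL)$, and let $(x_k),(y_k),(z_k)$ be generated by (M-APM) from initial points $x_0,y_0\in H$. Then all weak subsequential limit points of $(x_k)_{k\ge0}$, $(y_k)_{k\ge0}$ and $(z_k)_{k\ge0}$ belong to $\operatorname{argmin}(F)$.
   Context: $L$-smooth means $f$ is differentiable with $L$-Lipschitz gradient. $\operatorname{prox}_{sg}(v)=\operatorname{arg\,min}_{u\in H}\{g(u)+\frac{1}{2s}\|u-v\|^2\}$. The sequence $(t_k)_{k\ge0}$ is $t_0=1$, $t_k=\frac{1+\sqrt{1+4t_{k-1}^2}}{2}$ for $k\ge1$. A weak subsequential limit point of a sequence is the weak limit of some subsequence. Algorithm (M-APM): given $x_0,y_0\in H$, for $k\ge0$, $$z_k=\operatorname{prox}_{sg}(x_k-s\nabla f(x_k)),\qquad y_{k+1}=\begin{cases}z_k,&\text{if }F(z_k)\le F(y_k),\\ y_k,&\text{otherwise},\end{cases}$$ $$x_{k+1}=y_{k+1}+\frac{t_k-1}{t_{k+1}}(y_{k+1}-y_k)+\frac{t_k}{t_{k+1}}(z_k-y_{k+1})+\frac{t_k(\gamma-1)}{t_{k+1}}(z_k-x_k).$$ *)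

theory Defs
  imports "HOL-Analysis.Analysis"
begin

section \<open>Extended-real-valued functions\<close>

(* Properness includes that minus infinity is never attained, so a proper function is a map into
   the reals with plus infinity, and the sums of extended reals below are never of the
   form "infinity minus infinity". *)
definition proper_fun :: "('a \<Rightarrow> ereal) \<Rightarrow> bool" where
  "proper_fun g \<longleftrightarrow> (\<forall>x. g x \<noteq> -\<infinity>) \<and> (\<exists>x. g x \<noteq> \<infinity>)"

(* The convention 0 * \<infinity> = 0 of type ereal makes the end points u = 0 and u = 1 harmless. *)
definition convex_fun :: "('a::real_vector \<Rightarrow> ereal) \<Rightarrow> bool" where
  "convex_fun g \<longleftrightarrow> (\<forall>x y. \<forall>u\<in>{0..1::real}.
     g ((1 - u) *\<^sub>R x + u *\<^sub>R y) \<le> ereal (1 - u) * g x + ereal u * g y)"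

definition lsc_fun :: "('a::topological_space \<Rightarrow> ereal) \<Rightarrow> bool" where
  "lsc_fun g \<longleftrightarrow> (\<forall>x. g x \<le> Liminf (at x) g)"

definition argmin :: "('a \<Rightarrow> ereal) \<Rightarrow> 'a set" where
  "argmin h = {x. is_arg_min h (\<lambda>_. True) x}"

(* For s > 0 and g proper, convex and lower semicontinuous on a Hilbert space,
   the minimizer exists and is unique, so the choice made by ARG_MIN is immaterial. *)
definition prox :: "real \<Rightarrow> ('a::real_inner \<Rightarrow> ereal) \<Rightarrow> 'a \<Rightarrow> 'a" where
  "prox s g v = (ARG_MIN (\<lambda>u. g u + ereal (1 / (2 * s) * (norm (u - v))\<^sup>2)) u. True)"


section \<open>Smoothness and weak convergence\<close>

(* At a point of Frechet differentiability in a Hilbert space, the gradient exists by the Riesz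
   representation theorem and is unique. *)
definition gradient :: "('a::real_inner \<Rightarrow> real) \<Rightarrow> 'a \<Rightarrow> 'a" where
  "gradient f x = (THE D. GDERIV f x :> D)"

definition smooth_fun :: "real \<Rightarrow> ('a::real_inner \<Rightarrow> real) \<Rightarrow> bool" where
  "smooth_fun L f \<longleftrightarrow> (\<forall>x. f differentiable (at x)) \<and> L-lipschitz_on UNIV (gradient f)"

definition weakly_converges :: "(nat \<Rightarrow> 'a::real_inner) \<Rightarrow> 'a \<Rightarrow> bool" where
  "weakly_converges X l \<longleftrightarrow> (\<forall>h. (\<lambda>n. X n \<bullet> h) \<longlonglongrightarrow> l \<bullet> h)"

definition weak_limit_points :: "(nat \<Rightarrow> 'a::real_inner) \<Rightarrow> 'a set" where
  "weak_limit_points X = {l. \<exists>r::nat \<Rightarrow> nat. strict_mono r \<and> weakly_converges (X \<circ> r) l}"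


section \<open>The algorithm\<close>

definition composite :: "('a \<Rightarrow> real) \<Rightarrow> ('a \<Rightarrow> ereal) \<Rightarrow> 'a \<Rightarrow> ereal" where
  "composite f g x = ereal (f x) + g x"

primrec t_seq :: "nat \<Rightarrow> real" where
  "t_seq 0 = 1"
| "t_seq (Suc k) = (1 + sqrt (1 + 4 * (t_seq k)\<^sup>2)) / 2"

(* The initial points x 0 and y 0 are unconstrained. *)
definition m_apm ::
  "('a::real_inner \<Rightarrow> real) \<Rightarrow> ('a \<Rightarrow> ereal) \<Rightarrow> real \<Rightarrow> real \<Rightarrow>
    (nat \<Rightarrow> 'a) \<Rightarrow> (nat \<Rightarrow> 'a) \<Rightarrow> (nat \<Rightarrow> 'a) \<Rightarrow> bool" where
  "m_apm f g s \<gamma> x y z \<longleftrightarrow> (\<forall>k.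
     z k = prox s g (x k - s *\<^sub>R gradient f (x k)) \<and>
     y (Suc k) = (if composite f g (z k) \<le> composite f g (y k) then z k else y k) \<and>
     x (Suc k) = y (Suc k)
       + ((t_seq k - 1) / t_seq (Suc k)) *\<^sub>R (y (Suc k) - y k)
       + (t_seq k / t_seq (Suc k)) *\<^sub>R (z k - y (Suc k))
       + (t_seq k * (\<gamma> - 1) / t_seq (Suc k)) *\<^sub>R (z k - x k))"

end

theory Submission
  imports Defs
begin

text \<open>The combination \<open>p k = t k x k - (t k - 1) y k\<close> satisfies \<open>p (k + 1) = p k + \<gamma> t k (z k - x k)\<close>.
  Weighting the forward-backward inequality at \<open>y k\<close> and at a minimizer \<open>w\<close> with \<open>t k - 1\<close> and \<open>1\<close>
  shows that \<open>2 \<gamma> s (t k ^ 2 - t k) (F (y k) - min F) + norm (p k - w) ^ 2\<close> is nonincreasing, and it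
  bounds both \<open>2 \<gamma> s t k ^ 2 (F (z k) - min F)\<close> and \<open>\<gamma> (2 - s L - \<gamma>) t k ^ 2 norm (x k - z k) ^ 2\<close>.
  Since \<open>t k\<close> tends to infinity, \<open>y\<close> and \<open>z\<close> are minimizing sequences and \<open>x k - z k\<close> tends to \<open>0\<close>.

  Existence of proximal points supplies all of the Hilbert space theory: applied to \<open>F\<close> at a weak limit of
  a minimizing sequence it shows that this limit is a minimizer, and applied to a bounded linear
  functional it gives the Riesz representation, hence the gradient.\<close>


section \<open>Convexity, lower semicontinuity and existence of proximal points\<close>

lemma convex_fun_combination:
  assumes "convex_fun \<phi>" "0 \<le> t" "t \<le> (1::real)" "\<phi> a = ereal \<alpha>" "\<phi> b = ereal \<beta>"
  shows "\<phi> ((1 - t) *\<^sub>R a + t *\<^sub>R b) \<le> ereal ((1 - t) * \<alpha> + t * \<beta>)"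
proof -
  have "\<phi> ((1 - t) *\<^sub>R a + t *\<^sub>R b) \<le> ereal (1 - t) * \<phi> a + ereal t * \<phi> b"
    using assms(1-3) unfolding convex_fun_def by auto
  then show ?thesis using assms(4,5) by simp
qed

text \<open>\<open>lsc_fun\<close> only speaks of punctured neighbourhoods; the bound on
  \<open>\<phi> l\<close> itself covers the indices with \<open>X n = l\<close>.\<close>

lemma lsc_fun_eventually_greater:
  assumes "lsc_fun \<phi>" "X \<longlonglongrightarrow> l" "c < \<phi> l"
  shows "eventually (\<lambda>n. c < \<phi> (X n)) sequentially"
proof -
  have "c < Liminf (at l) \<phi>"
    using assms(1,3) unfolding lsc_fun_def by (meson less_le_trans)
  then have "eventually (\<lambda>w. c < \<phi> w) (at l)"
    by (rule less_LiminfD)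
  then have "eventually (\<lambda>w. c < \<phi> w) (nhds l)"
    using assms(3) by (auto simp: eventually_at_filter elim: eventually_mono)
  then show ?thesis
    using assms(2) unfolding filterlim_iff by blast
qed

lemma norm_midpoint_square:
  fixes a b v :: "'a::real_inner"
  shows "(norm ((1/2) *\<^sub>R a + (1/2) *\<^sub>R b - v))\<^sup>2 =
    (norm (a - v))\<^sup>2 / 2 + (norm (b - v))\<^sup>2 / 2 - (norm (a - b))\<^sup>2 / 4"
  by (simp add: power2_norm_eq_inner inner_diff inner_add inner_commute field_simps)

text \<open>Strong convexity of the proximal term makes a minimizing sequence Cauchy, and lower
  semicontinuity makes its limit a minimizer. The lower bound \<open>bdd\<close> stands in for an
  affine minorant of \<open>\<phi>\<close>; each application has one at hand.\<close>

lemma prox_is_arg_min: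
  fixes \<phi> :: "'a::{real_inner, complete_space} \<Rightarrow> ereal"
  assumes conv: "convex_fun \<phi>" and proper: "proper_fun \<phi>" and lsc: "lsc_fun \<phi>" and s: "s > 0"
    and bdd: "\<And>u. ereal m \<le> \<phi> u + ereal (1 / (2 * s) * (norm (u - v))\<^sup>2)"
  shows "is_arg_min (\<lambda>u. \<phi> u + ereal (1 / (2 * s) * (norm (u - v))\<^sup>2)) (\<lambda>_. True) (prox s \<phi> v)"
proof -
  define q where "q = (\<lambda>u. 1 / (2 * s) * (norm (u - v))\<^sup>2)"
  define D where "D = {u. \<phi> u \<noteq> \<infinity>}"
  \<comment> \<open>\<open>real_of_ereal\<close> sends infinity to \<open>0\<close>, so
    \<open>h\<close> is the proximal objective on \<open>D\<close> only.\<close>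
  define h where "h = (\<lambda>u. real_of_ereal (\<phi> u) + q u)"
  have fin: "\<phi> u = ereal (h u - q u)" if "u \<in> D" for u
    using that proper unfolding D_def h_def proper_fun_def by (cases "\<phi> u") auto
  have "D \<noteq> {}" using proper unfolding D_def proper_fun_def by auto
  have low: "m \<le> h u" if "u \<in> D" for u
    using bdd[of u] fin[OF that] by (simp add: q_def)
  define I where "I = Inf (h ` D)"
  have bdd_h: "bdd_below (h ` D)" using low by (rule bdd_belowI2)
  have I_le: "I \<le> h u" if "u \<in> D" for u
    unfolding I_def using bdd_h that by (intro cInf_lower) auto
  have "\<exists>u\<in>D. h u < I + 1 / Suc n" for n
    using cInf_lessD[of "h ` D" "I + 1 / Suc n"] \<open>D \<noteq> {}\<close> unfolding I_def by auto
  then obtain X where XD: "\<And>n. X n \<in> D" and Xh: "\<And>n. h (X n) < I + 1 / Suc n"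
    by metis
  \<comment> \<open>By the parallelogram law the objective at the midpoint undercuts the average by
    \<open>(norm (a - b))^2 / (8 * s)\<close>, yet stays above \<open>I\<close>.\<close>
  have mid: "(norm (a - b))\<^sup>2 \<le> 4 * s * ((h a - I) + (h b - I))" if "a \<in> D" "b \<in> D" for a b
  proof -
    define c where "c = (1/2) *\<^sub>R a + (1/2) *\<^sub>R b"
    have "\<phi> c \<le> ereal ((h a - q a) / 2 + (h b - q b) / 2)"
      using convex_fun_combination[OF conv, of "1/2" a _ b] fin[OF that(1)] fin[OF that(2)]
      by (simp add: c_def)
    moreover from this have "c \<in> D" by (auto simp: D_def)
    ultimately have "h c - q c \<le> (h a - q a) / 2 + (h b - q b) / 2"
      using fin by simp
    moreover have "q c = q a / 2 + q b / 2 - (norm (a - b))\<^sup>2 / (8 * s)"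
      unfolding q_def c_def norm_midpoint_square using s by (simp add: field_simps)
    moreover have "I \<le> h c" using I_le \<open>c \<in> D\<close> by blast
    ultimately have "(norm (a - b))\<^sup>2 / (8 * s) \<le> ((h a - I) + (h b - I)) / 2" by argo
    then show ?thesis using s by (simp add: field_simps)
  qed
  have "Cauchy X"
  proof (rule metric_CauchyI)
    fix e :: real assume "e > 0"
    \<comment> \<open>In \<open>mid\<close>, two excesses below \<open>1 / Suc N\<close> give the
      bound \<open>8 * s / Suc N\<close>.\<close>
    obtain N where N: "8 * s / e\<^sup>2 < real N" using reals_Archimedean2 by blast
    have N': "8 * s / Suc N < e\<^sup>2"
      using N s \<open>e > 0\<close> by (simp add: field_simps) (smt (verit) zero_less_power)
    have small: "h (X k) - I < 1 / Suc N" if "k \<ge> N" for k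
      using Xh[of k] that by (smt (verit) frac_le of_nat_0_less_iff of_nat_mono Suc_le_mono zero_less_Suc)
    have "dist (X i) (X j) < e" if "i \<ge> N" "j \<ge> N" for i j
    proof -
      have "(norm (X i - X j))\<^sup>2 \<le> 4 * s * ((h (X i) - I) + (h (X j) - I))"
        using mid XD by blast
      also have "\<dots> \<le> 4 * s * (1 / Suc N + 1 / Suc N)"
        using small[OF that(1)] small[OF that(2)] s by (intro mult_left_mono) auto
      also have "\<dots> < e\<^sup>2" using N' by simp
      finally show ?thesis
        using \<open>e > 0\<close> by (simp add: dist_norm power2_less_imp_less)
    qed
    then show "\<exists>M. \<forall>i\<ge>M. \<forall>j\<ge>M. dist (X i) (X j) < e" by blast
  qed
  then obtain p where p: "X \<longlonglongrightarrow> p"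
    using Cauchy_convergent convergent_def by blast
  have q_lim: "(\<lambda>n. q (X n)) \<longlonglongrightarrow> q p"
    unfolding q_def by (intro tendsto_intros p)
  have h_lim: "(\<lambda>n. h (X n)) \<longlonglongrightarrow> I"
  proof (rule real_tendsto_sandwich[where f = "\<lambda>_. I" and h = "\<lambda>n. I + 1 / Suc n"])
    show "(\<lambda>n. I + 1 / Suc n) \<longlonglongrightarrow> I"
      using tendsto_add[OF tendsto_const LIMSEQ_inverse_real_of_nat, of I]
      by (simp add: inverse_eq_divide)
  qed (use Xh XD I_le in \<open>auto intro!: always_eventually less_imp_le\<close>)
  \<comment> \<open>On the sequence \<open>\<phi>\<close> equals \<open>h - q\<close>, which
    converges to \<open>I - q p\<close>.\<close>
  have "\<phi> p \<le> ereal (I - q p)"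
  proof (rule ccontr)
    assume "\<not> ?thesis"
    then obtain c where c: "ereal (I - q p) < ereal c" "ereal c < \<phi> p"
      using ereal_dense2[of "ereal (I - q p)" "\<phi> p"] by (auto simp: not_le)
    have "eventually (\<lambda>n. ereal c < \<phi> (X n)) sequentially"
      by (rule lsc_fun_eventually_greater[OF lsc p c(2)])
    then have "eventually (\<lambda>n. c \<le> h (X n) - q (X n)) sequentially"
      using fin XD by (auto elim!: eventually_mono)
    then have "c \<le> I - q p"
      using tendsto_lowerbound[OF tendsto_diff[OF h_lim q_lim]] by simp
    then show False using c(1) by simp
  qed
  then have p_le: "\<phi> p + ereal (q p) \<le> ereal I"
    by (cases "\<phi> p") auto
  have "ereal I \<le> \<phi> u + ereal (q u)" for u
  proof (cases "u \<in> D")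
    case True
    then show ?thesis using I_le fin by simp
  qed (simp add: D_def)
  then have "is_arg_min (\<lambda>u. \<phi> u + ereal (q u)) (\<lambda>_. True) p"
    using p_le unfolding is_arg_min_def by (metis leD order_trans)
  then show ?thesis
    unfolding prox_def arg_min_def q_def by (rule someI)
qed

text \<open>First-order optimality: \<open>(v - p) / s\<close> is a subgradient of
  \<open>\<phi>\<close> at \<open>p\<close>. Compare \<open>p\<close> with
  \<open>p + t (u - p)\<close>, divide by \<open>t\<close> and let \<open>t\<close> decrease to
  0.\<close>

lemma proximal_variational_inequality:
  fixes \<phi> :: "'a::real_inner \<Rightarrow> ereal"
  assumes conv: "convex_fun \<phi>" and proper: "proper_fun \<phi>" and s: "s > 0"
    and min: "is_arg_min (\<lambda>u. \<phi> u + ereal (1 / (2 * s) * (norm (u - v))\<^sup>2)) (\<lambda>_. True) p"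
  shows "\<phi> p \<noteq> \<infinity>"
    and "\<phi> p + ereal (((v - p) \<bullet> (u - p)) / s) \<le> \<phi> u"
proof -
  have le: "\<phi> p + ereal (1 / (2 * s) * (norm (p - v))\<^sup>2) \<le> \<phi> w + ereal (1 / (2 * s) * (norm (w - v))\<^sup>2)" for w
    using min unfolding is_arg_min_def by (meson leI)
  obtain w where "\<phi> w \<noteq> \<infinity>" using proper unfolding proper_fun_def by auto
  then show "\<phi> p \<noteq> \<infinity>" using le[of w] by auto
  then obtain \<alpha> where \<alpha>: "\<phi> p = ereal \<alpha>"
    using proper unfolding proper_fun_def by (cases "\<phi> p") auto
  show "\<phi> p + ereal (((v - p) \<bullet> (u - p)) / s) \<le> \<phi> u"
  proof (cases "\<phi> u")
    case (real \<beta>)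
    define d where "d = u - p"
    have ineq: "0 \<le> \<beta> - \<alpha> + ((p - v) \<bullet> d) / s + t * (d \<bullet> d) / (2 * s)" if t: "0 < t" "t < 1" for t
    proof -
      have "\<phi> (p + t *\<^sub>R d) \<le> ereal ((1 - t) * \<alpha> + t * \<beta>)"
        using convex_fun_combination[OF conv _ _ \<alpha> real, of t] t
        by (simp add: d_def algebra_simps)
      from order_trans[OF le add_right_mono[OF this]]
      have "\<alpha> + 1 / (2 * s) * (norm (p - v))\<^sup>2 \<le>
          (1 - t) * \<alpha> + t * \<beta> + 1 / (2 * s) * (norm (p + t *\<^sub>R d - v))\<^sup>2"
        unfolding \<alpha> by simp
      then have "0 \<le> t * (\<beta> - \<alpha>) + 1 / (2 * s) * ((norm (p + t *\<^sub>R d - v))\<^sup>2 - (norm (p - v))\<^sup>2)"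
        unfolding right_diff_distrib left_diff_distrib by linarith
      also have "(norm (p + t *\<^sub>R d - v))\<^sup>2 - (norm (p - v))\<^sup>2 = 2 * t * ((p - v) \<bullet> d) + t * t * (d \<bullet> d)"
        by (simp add: power2_norm_eq_inner inner_diff inner_add inner_commute algebra_simps)
      also have "t * (\<beta> - \<alpha>) + 1 / (2 * s) * (2 * t * ((p - v) \<bullet> d) + t * t * (d \<bullet> d)) =
          t * (\<beta> - \<alpha> + ((p - v) \<bullet> d) / s + t * (d \<bullet> d) / (2 * s))"
        using s by (simp add: field_simps)
      finally show ?thesis using t by (simp add: zero_le_mult_iff)
    qed
    have "((\<lambda>t. \<beta> - \<alpha> + ((p - v) \<bullet> d) / s + t * (d \<bullet> d) / (2 * s)) \<longlongrightarrow>
        \<beta> - \<alpha> + ((p - v) \<bullet> d) / s + 0 * (d \<bullet> d) / (2 * s)) (at_right 0)"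
      using s by (intro tendsto_intros) auto
    moreover have "eventually (\<lambda>t. 0 \<le> \<beta> - \<alpha> + ((p - v) \<bullet> d) / s + t * (d \<bullet> d) / (2 * s)) (at_right 0)"
      using ineq by (auto simp: eventually_at_right_field intro!: exI[of _ 1])
    ultimately have "0 \<le> \<beta> - \<alpha> + ((p - v) \<bullet> d) / s"
      by (auto dest!: tendsto_lowerbound)
    then show ?thesis
      using \<alpha> real by (simp add: d_def inner_diff_left diff_divide_distrib)
  qed (use proper in \<open>auto simp: proper_fun_def\<close>)
qed

section \<open>Riesz representation and the gradient\<close>

text \<open>The representing vector is the minimizer of \<open>norm u ^ 2 / 2 - l u\<close>, that
  is, the proximal point of \<open>- l\<close> at 0.\<close>

lemma riesz_representation:
  fixes l :: "'a::{real_inner, complete_space} \<Rightarrow> real"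
  assumes "bounded_linear l"
  obtains D where "\<And>h. l h = h \<bullet> D"
proof -
  interpret bounded_linear l by fact
  obtain K where K: "\<And>h. norm (l h) \<le> norm h * K" using bounded by blast
  define \<phi> where "\<phi> = (\<lambda>u. ereal (- l u))"
  have conv: "convex_fun \<phi>"
    by (simp add: convex_fun_def \<phi>_def add scaleR)
  have proper: "proper_fun \<phi>"
    by (simp add: proper_fun_def \<phi>_def)
  have "continuous (at u) l" for u by (rule linear_continuous_at[OF assms])
  then have "(\<phi> \<longlongrightarrow> \<phi> u) (at u)" for u
    unfolding \<phi>_def by (intro tendsto_ereal tendsto_minus) (simp add: continuous_at)
  then have lsc: "lsc_fun \<phi>"
    by (auto simp: lsc_fun_def le_Liminf_iff intro: order_tendstoD(1))
  have bdd: "ereal (- K\<^sup>2 / 2) \<le> \<phi> u + ereal (1 / (2 * 1) * (norm (u - 0))\<^sup>2)" for u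
  proof -
    have "0 \<le> (norm u - K)\<^sup>2" by simp
    then show ?thesis using K[of u] unfolding \<phi>_def by (simp add: power2_diff algebra_simps)
  qed
  define p where "p = prox 1 \<phi> 0"
  have *: "l (u - p) \<le> (u - p) \<bullet> p" for u
    using proximal_variational_inequality(2)[OF conv proper _ prox_is_arg_min[OF conv proper lsc _ bdd], of u]
    by (simp add: p_def \<phi>_def diff inner_commute)
  \<comment> \<open>Opposite directions turn the variational inequality into an equality.\<close>
  have "l h = h \<bullet> p" for h
    using *[of "p + h"] *[of "p - h"] by (simp add: neg)
  then show ?thesis using that by blast
qed

text \<open>\<open>gradient\<close> is a definite description: Riesz gives existence, uniqueness of
  the derivative gives the rest.\<close>

lemma GDERIV_gradient:
  fixes f :: "'a::{real_inner, complete_space} \<Rightarrow> real"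
  assumes "f differentiable (at x)"
  shows "GDERIV f x :> gradient f x"
proof -
  obtain f' where f': "(f has_derivative f') (at x)"
    using assms unfolding differentiable_def by blast
  obtain D where "\<And>h. f' h = h \<bullet> D"
    using riesz_representation[OF has_derivative_bounded_linear[OF f']] by blast
  then have D: "GDERIV f x :> D"
    using f' unfolding gderiv_def by presburger
  have "E = D" if "GDERIV f x :> E" for E
  proof -
    have "(\<lambda>h. h \<bullet> E) = (\<lambda>h. h \<bullet> D)"
      using that D unfolding gderiv_def by (rule has_derivative_unique)
    then show ?thesis by (metis inner_commute vector_eq_rdot)
  qed
  then show ?thesis unfolding gradient_def using D by (metis theI')
qed

section \<open>First-order inequalities for convex and for smooth functions\<close>

lemma has_real_derivative_along_line:
  fixes f :: "'a::{real_inner, complete_space} \<Rightarrow> real"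
  assumes "\<And>x. f differentiable (at x)"
  shows "((\<lambda>t. f (x + t *\<^sub>R d)) has_real_derivative gradient f (x + t *\<^sub>R d) \<bullet> d) (at t)"
proof -
  have "(f has_derivative (\<lambda>h. h \<bullet> gradient f (x + t *\<^sub>R d))) (at (x + t *\<^sub>R d))"
    using GDERIV_gradient[OF assms] unfolding gderiv_def .
  then have "((\<lambda>t. f (x + t *\<^sub>R d)) has_derivative (\<lambda>h. (h *\<^sub>R d) \<bullet> gradient f (x + t *\<^sub>R d))) (at t)"
    by (rule has_derivative_compose[rotated]) (auto intro!: derivative_eq_intros)
  then show ?thesis
    unfolding has_field_derivative_def by (simp add: inner_commute mult_commute_abs)
qed

text \<open>The restriction of \<open>f\<close> to the line through \<open>x\<close> and
  \<open>u\<close> lies above its tangent at 0; evaluate at 1.\<close>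

lemma convex_gradient_inequality:
  fixes f :: "'a::{real_inner, complete_space} \<Rightarrow> real"
  assumes conv: "convex_on UNIV f" and diff: "\<And>x. f differentiable (at x)"
  shows "f x + gradient f x \<bullet> (u - x) \<le> f u"
proof -
  define \<phi> where "\<phi> = (\<lambda>t. f (x + t *\<^sub>R (u - x)))"
  have "convex_on UNIV \<phi>"
  proof (rule convex_onI)
    fix t a b :: real assume "0 < t" "t < 1"
    have "x + ((1 - t) * a + t * b) *\<^sub>R (u - x) =
        (1 - t) *\<^sub>R (x + a *\<^sub>R (u - x)) + t *\<^sub>R (x + b *\<^sub>R (u - x))"
      by (simp add: algebra_simps)
    then show "\<phi> ((1 - t) *\<^sub>R a + t *\<^sub>R b) \<le> (1 - t) * \<phi> a + t * \<phi> b"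
      using convex_onD[OF conv, of t] \<open>0 < t\<close> \<open>t < 1\<close> by (simp add: \<phi>_def)
  qed simp
  moreover have "(\<phi> has_real_derivative gradient f x \<bullet> (u - x)) (at 0)"
    using has_real_derivative_along_line[OF diff, of x "u - x" 0] by (simp add: \<phi>_def)
  ultimately have "\<phi> 1 - \<phi> 0 \<ge> (gradient f x \<bullet> (u - x)) * (1 - 0)"
    by (intro convex_on_imp_above_tangent[of UNIV]) auto
  then show ?thesis by (simp add: \<phi>_def)
qed

text \<open>Along the segment, \<open>\<psi>\<close> is \<open>f\<close> minus the nonconstant part
  of the claimed quadratic bound. Cauchy-Schwarz and the Lipschitz gradient make its derivative
  nonpositive.\<close>

lemma smooth_descent_inequality:
  fixes f :: "'a::{real_inner, complete_space} \<Rightarrow> real"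
  assumes "smooth_fun L f"
  shows "f u \<le> f x + gradient f x \<bullet> (u - x) + L / 2 * (norm (u - x))\<^sup>2"
proof -
  define d where "d = u - x"
  define \<psi> where "\<psi> = (\<lambda>t. f (x + t *\<^sub>R d) - t * (gradient f x \<bullet> d) - L / 2 * t\<^sup>2 * (norm d)\<^sup>2)"
  have diff: "\<And>x. f differentiable (at x)" and lip: "L-lipschitz_on UNIV (gradient f)"
    using assms unfolding smooth_fun_def by auto
  have "\<psi> 1 \<le> \<psi> 0"
  proof (rule DERIV_nonpos_imp_nonincreasing[of 0 1 \<psi>])
    fix t :: real assume t: "0 \<le> t" "t \<le> 1"
    have "(\<psi> has_real_derivative gradient f (x + t *\<^sub>R d) \<bullet> d - gradient f x \<bullet> d - L * t * (norm d)\<^sup>2) (at t)"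
      unfolding \<psi>_def
      by (rule derivative_eq_intros has_real_derivative_along_line[OF diff] refl | simp)+
    moreover have "gradient f (x + t *\<^sub>R d) \<bullet> d - gradient f x \<bullet> d - L * t * (norm d)\<^sup>2 \<le> 0"
    proof -
      have "(gradient f (x + t *\<^sub>R d) - gradient f x) \<bullet> d \<le> norm (gradient f (x + t *\<^sub>R d) - gradient f x) * norm d"
        by (rule norm_cauchy_schwarz)
      also have "\<dots> \<le> L * norm (t *\<^sub>R d) * norm d"
        using lipschitz_onD[OF lip, of "x + t *\<^sub>R d" x] by (intro mult_right_mono) (auto simp: dist_norm)
      also have "\<dots> = L * t * (norm d)\<^sup>2" using t by (simp add: power2_eq_square)
      finally show ?thesis by (simp add: inner_diff_left)
    qed
    ultimately show "\<exists>w. (\<psi> has_real_derivative w) (at t) \<and> w \<le> 0" by blast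
  qed simp
  then show ?thesis by (simp add: \<psi>_def d_def)
qed

section \<open>The composite objective and its minimizing sequences\<close>

lemma argmin_iff: "x \<in> argmin h \<longleftrightarrow> (\<forall>u. h x \<le> h u)"
  by (auto simp: argmin_def is_arg_min_def not_less)

lemma convex_fun_composite:
  fixes f :: "'a::real_vector \<Rightarrow> real"
  assumes "convex_on UNIV f" "convex_fun g" "proper_fun g"
  shows "convex_fun (composite f g)"
  unfolding convex_fun_def
proof (intro allI ballI)
  fix a b :: 'a and t :: real assume t: "t \<in> {0..1}"
  let ?c = "(1 - t) *\<^sub>R a + t *\<^sub>R b"
  have "f ?c \<le> (1 - t) * f a + t * f b"
    using convex_onD[OF assms(1)] t by auto
  moreover have "g ?c \<le> ereal (1 - t) * g a + ereal t * g b"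
    using assms(2) t unfolding convex_fun_def by blast
  ultimately have "composite f g ?c \<le>
      ereal ((1 - t) * f a + t * f b) + (ereal (1 - t) * g a + ereal t * g b)"
    unfolding composite_def by (intro add_mono) auto
  \<comment> \<open>The end points are separate cases because 0 times infinity is 0 there.\<close>
  also have "\<dots> = ereal (1 - t) * composite f g a + ereal t * composite f g b"
    using assms(3) t unfolding composite_def proper_fun_def
    by (cases "g a"; cases "g b"; cases "t = 0"; cases "t = 1") (auto simp: algebra_simps)
  finally show "composite f g ?c \<le> ereal (1 - t) * composite f g a + ereal t * composite f g b" .
qed

lemma proper_fun_composite:
  assumes "proper_fun g"
  shows "proper_fun (composite f g)"
  using assms unfolding proper_fun_def composite_def by auto

lemma lsc_fun_composite:
  assumes "\<And>x. isCont f x" "lsc_fun g" "proper_fun g"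
  shows "lsc_fun (composite f g)"
  unfolding lsc_fun_def le_Liminf_iff
proof (intro allI impI)
  fix x c assume c: "c < composite f g x"
  show "eventually (\<lambda>u. c < composite f g u) (at x)"
  proof (cases c)
    case (real r)
    have "ereal (r - f x) < g x"
      using c real by (cases "g x") (auto simp: composite_def)
    \<comment> \<open>Writing \<open>r = (r - q) + q\<close>, near \<open>x\<close> the first
      summand is exceeded by \<open>f\<close> and the second by \<open>g\<close>.\<close>
    then obtain q where q: "ereal (r - f x) < ereal q" "ereal q < g x"
      using ereal_dense2 by blast
    have "eventually (\<lambda>u. ereal q < g u) (at x)"
      using assms(2) q(2) unfolding lsc_fun_def le_Liminf_iff by blast
    moreover have "eventually (\<lambda>u. r - q < f u) (at x)"
      using assms(1)[of x] q(1) by (intro order_tendstoD(1)) (auto simp: isCont_def)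
    ultimately show ?thesis
    proof eventually_elim
      case (elim u)
      then show ?case by (cases "g u") (auto simp: composite_def real)
    qed
  next
    case MInf
    then show ?thesis using assms(3)
      by (auto simp: composite_def proper_fun_def less_le intro!: always_eventually)
  qed (use c in auto)
qed

text \<open>With \<open>p\<close> the proximal point of \<open>l\<close>, the variational inequality
  is affine in \<open>u\<close>, so it passes to the weak limit along \<open>X\<close>:
  \<open>\<phi> p + norm (l - p) ^ 2\<close> is at most the minimum. Hence \<open>l = p\<close>, and
  \<open>p\<close> is a minimizer.\<close>

lemma weak_limit_of_minimizing_sequence:
  fixes \<phi> :: "'a::{real_inner, complete_space} \<Rightarrow> ereal"
  assumes conv: "convex_fun \<phi>" and proper: "proper_fun \<phi>" and lsc: "lsc_fun \<phi>"
    and w: "w \<in> argmin \<phi>" and X: "weakly_converges X l" and lim: "(\<lambda>n. \<phi> (X n)) \<longlonglongrightarrow> \<phi> w"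
  shows "l \<in> argmin \<phi>"
proof -
  have min: "\<phi> w \<le> \<phi> u" for u using w by (simp add: argmin_iff)
  obtain a where a: "\<phi> w = ereal a"
    using proper min unfolding proper_fun_def by (metis ereal_infty_less_eq(1) ereal_cases)
  have bdd: "ereal a \<le> \<phi> u + ereal (1 / (2 * 1) * (norm (u - l))\<^sup>2)" for u
    using add_mono[OF min[of u], of 0 "ereal (1 / (2 * 1) * (norm (u - l))\<^sup>2)"] a by simp
  define p where "p = prox 1 \<phi> l"
  have var: "\<phi> p + ereal ((l - p) \<bullet> (u - p)) \<le> \<phi> u" for u
    using proximal_variational_inequality(2)[OF conv proper _ prox_is_arg_min[OF conv proper lsc _ bdd], of u]
    by (simp add: p_def)
  have "(\<lambda>n. (X n - p) \<bullet> (l - p)) \<longlonglongrightarrow> (l - p) \<bullet> (l - p)"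
    unfolding inner_diff_left[of _ p]
    using X[unfolded weakly_converges_def] by (intro tendsto_diff tendsto_const) blast
  then have "(\<lambda>n. \<phi> p + ereal ((l - p) \<bullet> (X n - p))) \<longlonglongrightarrow> \<phi> p + ereal ((l - p) \<bullet> (l - p))"
    using proper unfolding proper_fun_def
    by (intro tendsto_add_ereal_general tendsto_const tendsto_ereal) (auto simp: inner_commute)
  then have "\<phi> p + ereal ((l - p) \<bullet> (l - p)) \<le> ereal a"
    using lim a var by (intro LIMSEQ_le[OF _ lim[unfolded a]]) auto
  moreover have "ereal a \<le> \<phi> p" using min a by metis
  ultimately have "(l - p) \<bullet> (l - p) \<le> 0" "\<phi> p = ereal a"
    by (cases "\<phi> p"; simp; smt (verit) inner_ge_zero)+
  moreover from this(1) have "l = p"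
    using inner_ge_zero[of "l - p"] by (simp add: order.antisym[of "(l - p) \<bullet> (l - p)"])
  ultimately have "\<phi> l = \<phi> w" using a by simp
  then show ?thesis using min by (simp add: argmin_iff)
qed

section \<open>Growth and recursion of the inertial sequence\<close>

lemma t_seq_lower_bound: "1 + real k / 2 \<le> t_seq k"
proof (induction k)
  case (Suc k)
  have "2 * t_seq k \<le> sqrt (1 + 4 * (t_seq k)\<^sup>2)"
    by (intro real_le_rsqrt) (simp add: power2_eq_square)
  then show ?case using Suc by (simp add: field_simps)
qed simp

lemma t_seq_ge_1: "1 \<le> t_seq k"
  using t_seq_lower_bound[of k] by simp

text \<open>\<open>t_seq (Suc k)\<close> is the positive root of
  \<open>r^2 - r = (t_seq k)^2\<close>. This lets the energy at \<open>Suc k\<close> match the bound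
  produced by step \<open>k\<close>.\<close>

lemma t_seq_Suc_square: "(t_seq (Suc k))\<^sup>2 - t_seq (Suc k) = (t_seq k)\<^sup>2"
proof -
  have "(sqrt (1 + 4 * (t_seq k)\<^sup>2))\<^sup>2 = 1 + 4 * (t_seq k)\<^sup>2" by (simp add: add_nonneg_nonneg)
  then show ?thesis by (simp add: power2_eq_square field_simps)
qed

lemma t_seq_at_top: "filterlim t_seq at_top sequentially"
  unfolding filterlim_at_top eventually_sequentially
proof
  fix c :: real
  obtain N where N: "2 * c \<le> real N" using real_arch_simple by blast
  have "c \<le> t_seq k" if "N \<le> k" for k
    using t_seq_lower_bound[of k] N that by linarith
  then show "\<exists>N. \<forall>k\<ge>N. c \<le> t_seq k" by blast
qed

section \<open>The forward-backward step\<close>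

text \<open>Sum of three estimates: optimality of \<open>z\<close> for the proximal problem,
  convexity of \<open>f\<close> from \<open>x\<close> to \<open>u\<close>, descent of
  \<open>f\<close> from \<open>x\<close> to \<open>z\<close>. The coefficient
  \<open>(2 - s * L) / (2 * s)\<close>, sharper than \<open>1 / (2 * s)\<close> when
  \<open>s * L < 1\<close>, is what admits every \<open>\<gamma>\<close> below
  \<open>2 - s * L\<close>.\<close>

lemma forward_backward_inequality:
  fixes f :: "'a::{real_inner, complete_space} \<Rightarrow> real"
  assumes L: "L > 0" and f: "convex_on UNIV f" "smooth_fun L f"
    and g: "convex_fun g" "proper_fun g" "lsc_fun g"
    and bdd: "\<And>u. ereal a \<le> composite f g u"
    and s: "0 < s" "s \<le> 1 / L"
    and z: "z = prox s g (x - s *\<^sub>R gradient f x)"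
  shows "composite f g z \<noteq> \<infinity>"
    and "composite f g z + ereal (((x - z) \<bullet> (u - x)) / s + (2 - s * L) / (2 * s) * (norm (x - z))\<^sup>2)
      \<le> composite f g u"
proof -
  define G where "G = gradient f x"
  define v where "v = x - s *\<^sub>R G"
  have desc: "f w \<le> f x + G \<bullet> (w - x) + L / 2 * (norm (w - x))\<^sup>2" for w
    unfolding G_def by (rule smooth_descent_inequality[OF f(2)])
  \<comment> \<open>Completing the square: up to a constant, the proximal term at \<open>v\<close>
    is the linear term of \<open>f\<close> at \<open>x\<close> plus a quadratic.\<close>
  have sq: "1 / (2 * s) * (norm (w - v))\<^sup>2 =
      1 / (2 * s) * (norm (w - x))\<^sup>2 + G \<bullet> (w - x) + s / 2 * (norm G)\<^sup>2" for w
    using s unfolding v_def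
    by (simp add: power2_norm_eq_inner inner_diff inner_add inner_commute field_simps)
  \<comment> \<open>The lower bound of \<open>F\<close> transfers to the proximal objective because \<open>s L \<le> 1\<close>.\<close>
  have "ereal (a - f x + s / 2 * (norm G)\<^sup>2) \<le> g w + ereal (1 / (2 * s) * (norm (w - v))\<^sup>2)" for w
  proof (cases "g w")
    case (real r)
    have "L / 2 * (norm (w - x))\<^sup>2 \<le> 1 / (2 * s) * (norm (w - x))\<^sup>2"
      using s L by (intro mult_right_mono) (auto simp: field_simps)
    then show ?thesis
      using bdd[of w] desc[of w] unfolding sq real composite_def by simp
  qed (use bdd[of w] in \<open>auto simp: composite_def\<close>)
  moreover have zv: "z = prox s g v" using z by (simp add: v_def G_def)
  ultimately have min: "is_arg_min (\<lambda>w. g w + ereal (1 / (2 * s) * (norm (w - v))\<^sup>2)) (\<lambda>_. True) z"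
    using prox_is_arg_min[OF g s(1)] by blast
  note var = proximal_variational_inequality[OF g(1,2) s(1) min]
  show "composite f g z \<noteq> \<infinity>" using var(1) unfolding composite_def by auto
  have "g z + ereal (((v - z) \<bullet> (u - z)) / s) \<le> g u" by (rule var(2))
  moreover have "f z + ((x - z) \<bullet> (u - x)) / s + (2 - s * L) / (2 * s) * (norm (x - z))\<^sup>2
      \<le> f u + ((v - z) \<bullet> (u - z)) / s"
  proof -
    have "f x + G \<bullet> (u - x) \<le> f u"
      using convex_gradient_inequality[OF f(1)] f(2) unfolding G_def smooth_fun_def by blast
    moreover have "((v - z) \<bullet> (u - z)) / s = ((x - z) \<bullet> (u - z)) / s - G \<bullet> (u - z)"
      using s by (simp add: v_def inner_diff_left inner_add_left field_simps)
    moreover have "G \<bullet> (u - z) = G \<bullet> (u - x) - G \<bullet> (z - x)" 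
      by (simp add: inner_diff_right)
    moreover have "(x - z) \<bullet> (u - z) = (x - z) \<bullet> (u - x) + (norm (x - z))\<^sup>2"
      by (simp add: power2_norm_eq_inner inner_diff algebra_simps)
    \<comment> \<open>Recentring the inner product at \<open>x\<close> gains \<open>1 / s\<close>
      times the squared residual; the descent inequality costs \<open>L / 2\<close> times
      it.\<close>
    moreover have "(2 - s * L) / (2 * s) * (norm (x - z))\<^sup>2 = (norm (x - z))\<^sup>2 / s - L / 2 * (norm (x - z))\<^sup>2"
      using s by (simp add: field_simps)
    ultimately show ?thesis
      using desc[of z] by (simp add: norm_minus_commute add_divide_distrib)
  qed
  ultimately show "composite f g z + ereal (((x - z) \<bullet> (u - x)) / s + (2 - s * L) / (2 * s) * (norm (x - z))\<^sup>2)
      \<le> composite f g u"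
    using g(2) unfolding proper_fun_def composite_def by (cases "g z"; cases "g u") auto
qed

section \<open>Energy decay along a run of the algorithm\<close>

locale m_apm_run =
  fixes f :: "'a::{real_inner, complete_space} \<Rightarrow> real" and g :: "'a \<Rightarrow> ereal"
    and L s \<gamma> a :: real and x y z :: "nat \<Rightarrow> 'a" and w :: 'a
  assumes L: "L > 0" and f_convex: "convex_on UNIV f" and f_smooth: "smooth_fun L f"
    and g_convex: "convex_fun g" and g_proper: "proper_fun g" and g_lsc: "lsc_fun g"
    and s: "0 < s" "s \<le> 1 / L" and \<gamma>: "0 < \<gamma>" "\<gamma> < 2 - s * L"
    and run: "m_apm f g s \<gamma> x y z"
    and minimizer: "w \<in> argmin (composite f g)" and min_value: "composite f g w = ereal a"
begin

abbreviation "F \<equiv> composite f g"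

text \<open>The inertial terms of the algorithm are chosen so that \<open>p\<close> moves by a multiple of the
  residual \<open>z k - x k\<close> alone (lemma \<open>p_Suc\<close>).\<close>

definition p :: "nat \<Rightarrow> 'a" where
  "p k = t_seq k *\<^sub>R x k - (t_seq k - 1) *\<^sub>R y k"

definition gap :: "'a \<Rightarrow> real" where
  "gap u = real_of_ereal (F u) - a"

text \<open>\<open>F (y 0)\<close> may be infinite, but its junk gap has the coefficient \<open>t_seq 0 ^ 2 - t_seq 0 = 0\<close>.\<close>

definition energy :: "nat \<Rightarrow> real" where
  "energy k = 2 * \<gamma> * s * ((t_seq k)\<^sup>2 - t_seq k) * gap (y k) + (norm (p k - w))\<^sup>2"

lemma F_ge: "ereal a \<le> F u"
  using minimizer unfolding argmin_iff min_value by blast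

lemma F_eq_gap: "F u \<noteq> \<infinity> \<Longrightarrow> F u = ereal (a + gap u)"
  using F_ge[of u] unfolding gap_def by (cases "F u") auto

lemma gap_nonneg: "F u \<noteq> \<infinity> \<Longrightarrow> 0 \<le> gap u"
  using F_ge[of u] F_eq_gap[of u] by simp

lemma z_eq: "z k = prox s g (x k - s *\<^sub>R gradient f (x k))"
  using run unfolding m_apm_def by blast

lemma F_y_Suc_le: "F (y (Suc k)) \<le> F (z k)"
proof -
  have "y (Suc k) = (if F (z k) \<le> F (y k) then z k else y k)"
    using run unfolding m_apm_def by blast
  then show ?thesis by auto
qed

lemmas forward_backward = forward_backward_inequality
  [OF L f_convex f_smooth g_convex g_proper g_lsc F_ge s z_eq]

lemma F_z_finite: "F (z k) \<noteq> \<infinity>"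
  by (rule forward_backward(1))

lemma F_y_Suc_finite: "F (y (Suc k)) \<noteq> \<infinity>"
  using F_y_Suc_le[of k] F_z_finite[of k] by auto

lemma gap_y_Suc_le: "gap (y (Suc k)) \<le> gap (z k)"
  using F_y_Suc_le[of k] F_eq_gap[OF F_y_Suc_finite[of k]] F_eq_gap[OF F_z_finite[of k]] by simp

lemma gap_step:
  assumes "F u \<noteq> \<infinity>"
  shows "gap (z k) + ((x k - z k) \<bullet> (u - x k)) / s + (2 - s * L) / (2 * s) * (norm (x k - z k))\<^sup>2 \<le> gap u"
  using forward_backward(2)[of k u] unfolding F_eq_gap[OF assms] F_eq_gap[OF F_z_finite[of k]] by simp

lemma gap_w: "gap w = 0"
  by (simp add: gap_def min_value)

lemma p_Suc: "p (Suc k) = p k + (\<gamma> * t_seq k) *\<^sub>R (z k - x k)"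
proof -
  have "t_seq (Suc k) \<noteq> 0" using t_seq_ge_1[of "Suc k"] by (auto simp del: t_seq.simps)
  moreover have "x (Suc k) = y (Suc k)
       + ((t_seq k - 1) / t_seq (Suc k)) *\<^sub>R (y (Suc k) - y k)
       + (t_seq k / t_seq (Suc k)) *\<^sub>R (z k - y (Suc k))
       + (t_seq k * (\<gamma> - 1) / t_seq (Suc k)) *\<^sub>R (z k - x k)"
    using run unfolding m_apm_def by blast
  \<comment> \<open>With denominators cleared, \<open>y (Suc k)\<close> has total coefficient
    \<open>t_seq (Suc k) - 1\<close>, exactly what \<open>p (Suc k)\<close> subtracts.\<close>
  ultimately have "t_seq (Suc k) *\<^sub>R x (Suc k) = t_seq (Suc k) *\<^sub>R y (Suc k)
       + (t_seq k - 1) *\<^sub>R (y (Suc k) - y k) + t_seq k *\<^sub>R (z k - y (Suc k))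
       + (t_seq k * (\<gamma> - 1)) *\<^sub>R (z k - x k)"
    by (simp add: scaleR_add_right del: t_seq.simps)
  then show ?thesis
    unfolding p_def by (simp add: algebra_simps del: t_seq.simps)
qed

lemma energy_step:
  "2 * \<gamma> * s * (t_seq k)\<^sup>2 * gap (z k) + \<gamma> * (2 - s * L - \<gamma>) * (t_seq k)\<^sup>2 * (norm (x k - z k))\<^sup>2
    + (norm (p (Suc k) - w))\<^sup>2 \<le> energy k"
proof -
  define t where "t = t_seq k"
  define d where "d = x k - z k"
  define D where "D = (norm d)\<^sup>2"
  have t: "1 \<le> t" unfolding t_def by (rule t_seq_ge_1)
  have "(t - 1) * (gap (z k) + (d \<bullet> (y k - x k)) / s + (2 - s * L) / (2 * s) * D) \<le> (t - 1) * gap (y k)"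
  \<comment> \<open>\<open>gap_step\<close> needs \<open>F (y k)\<close> finite, which is guaranteed
    for positive \<open>k\<close> only; at \<open>k = 0\<close> the weight \<open>t - 1\<close>
    vanishes.\<close>
  proof (cases k)
    case (Suc j)
    then show ?thesis
      using gap_step[OF F_y_Suc_finite[of j], of k] t unfolding d_def D_def by (intro mult_left_mono) auto
  qed (simp add: t_def)
  moreover have "gap (z k) + (d \<bullet> (w - x k)) / s + (2 - s * L) / (2 * s) * D \<le> 0"
    using gap_step[of w k] gap_w unfolding d_def D_def by (simp add: min_value)
  ultimately have "t * gap (z k) + ((t - 1) * (d \<bullet> (y k - x k)) + d \<bullet> (w - x k)) / s
      + t * ((2 - s * L) / (2 * s) * D) \<le> (t - 1) * gap (y k)"
    by (simp add: algebra_simps add_divide_distrib diff_divide_distrib)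
  \<comment> \<open>The weights are chosen so that \<open>(t - 1) (y k - x k) + (w - x k)\<close> is
    \<open>w - p k\<close>.\<close>
  also have "(t - 1) * (d \<bullet> (y k - x k)) + d \<bullet> (w - x k) = - (d \<bullet> (p k - w))"
    by (simp add: p_def t_def inner_diff_right algebra_simps)
  \<comment> \<open>The factor \<open>2 * \<gamma> * s * t\<close> makes the cross term agree with
    that of \<open>norm (p (Suc k) - w) ^ 2\<close>. Its quadratic term, with coefficient
    \<open>\<gamma>^2 * t^2\<close>, then leaves
    \<open>\<gamma> * (2 - s * L - \<gamma>) * t^2\<close>.\<close>
  finally have "2 * \<gamma> * s * t * (t * gap (z k) + - (d \<bullet> (p k - w)) / s + t * ((2 - s * L) / (2 * s) * D))
      \<le> 2 * \<gamma> * s * t * ((t - 1) * gap (y k))"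
    using \<gamma> s t by (intro mult_left_mono) auto
  moreover have "2 * \<gamma> * s * t * (t * gap (z k) + - (d \<bullet> (p k - w)) / s + t * ((2 - s * L) / (2 * s) * D)) =
      2 * \<gamma> * s * t\<^sup>2 * gap (z k) - 2 * \<gamma> * t * (d \<bullet> (p k - w)) + \<gamma> * (2 - s * L) * t\<^sup>2 * D"
    using s(1) by (simp add: field_simps power2_eq_square)
  moreover have "2 * \<gamma> * s * t * ((t - 1) * gap (y k)) = 2 * \<gamma> * s * (t\<^sup>2 - t) * gap (y k)"
    by (simp add: algebra_simps power2_eq_square)
  ultimately have "2 * \<gamma> * s * t\<^sup>2 * gap (z k) - 2 * \<gamma> * t * (d \<bullet> (p k - w)) + \<gamma> * (2 - s * L) * t\<^sup>2 * D
      \<le> 2 * \<gamma> * s * (t\<^sup>2 - t) * gap (y k)"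
    by linarith
  moreover have "(norm (p (Suc k) - w))\<^sup>2 = (norm (p k - w))\<^sup>2 - 2 * \<gamma> * t * (d \<bullet> (p k - w)) + \<gamma>\<^sup>2 * t\<^sup>2 * D"
  proof -
    have "(norm (b - (\<gamma> * t) *\<^sub>R d))\<^sup>2 = (norm b)\<^sup>2 - 2 * \<gamma> * t * (d \<bullet> b) + \<gamma>\<^sup>2 * t\<^sup>2 * D" for b
      unfolding D_def power2_norm_eq_inner
      by (simp add: inner_diff inner_commute power2_eq_square algebra_simps)
    moreover have "p (Suc k) - w = (p k - w) - (\<gamma> * t) *\<^sub>R d"
      unfolding p_Suc d_def t_def by (simp add: algebra_simps)
    ultimately show ?thesis by (simp only:)
  qed
  ultimately show ?thesis
    unfolding energy_def t_def[symmetric] d_def[symmetric] D_def[symmetric]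
    by (simp add: algebra_simps power2_eq_square)
qed

text \<open>By the recursion of \<open>t_seq\<close>, the energy at \<open>Suc k\<close> weights
  \<open>gap (y (Suc k))\<close> with \<open>(t_seq k)^2\<close>; replacing this gap by
  \<open>gap (z k)\<close> reaches the left side of \<open>energy_step\<close>.\<close>

lemma energy_le: "energy k \<le> energy 0"
proof (induction k)
  case (Suc k)
  have "energy (Suc k) = 2 * \<gamma> * s * (t_seq k)\<^sup>2 * gap (y (Suc k)) + (norm (p (Suc k) - w))\<^sup>2"
    unfolding energy_def t_seq_Suc_square ..
  also have "\<dots> \<le> 2 * \<gamma> * s * (t_seq k)\<^sup>2 * gap (z k) + (norm (p (Suc k) - w))\<^sup>2"
    using gap_y_Suc_le[of k] \<gamma> s by (intro add_right_mono mult_left_mono) auto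
  also have "\<dots> \<le> energy k"
  proof -
    have "0 \<le> \<gamma> * (2 - s * L - \<gamma>) * (t_seq k)\<^sup>2 * (norm (x k - z k))\<^sup>2" using \<gamma> by simp
    then show ?thesis using energy_step[of k] by linarith
  qed
  finally show ?case using Suc by simp
qed simp

text \<open>All terms on the left of \<open>energy_step\<close> are nonnegative, so each is bounded
  by \<open>energy 0\<close>. Strictness of \<open>\<gamma> < 2 - s * L\<close> permits the second
  division.\<close>

lemma gap_z_bound: "gap (z k) \<le> energy 0 / (2 * \<gamma> * s) / (t_seq k)\<^sup>2"
  and residual_bound: "(norm (x k - z k))\<^sup>2 \<le> energy 0 / (\<gamma> * (2 - s * L - \<gamma>)) / (t_seq k)\<^sup>2"
proof -
  have t: "0 < (t_seq k)\<^sup>2" using t_seq_ge_1[of k] by simp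
  have "0 \<le> 2 * \<gamma> * s * (t_seq k)\<^sup>2 * gap (z k)"
    using gap_nonneg[OF F_z_finite[of k]] \<gamma> s by simp
  moreover have "0 \<le> \<gamma> * (2 - s * L - \<gamma>) * (t_seq k)\<^sup>2 * (norm (x k - z k))\<^sup>2" using \<gamma> by simp
  moreover note energy_step[of k] energy_le[of k] zero_le_power2[of "norm (p (Suc k) - w)"]
  ultimately have 1: "(2 * \<gamma> * s * (t_seq k)\<^sup>2) * gap (z k) \<le> energy 0"
    and 2: "(\<gamma> * (2 - s * L - \<gamma>) * (t_seq k)\<^sup>2) * (norm (x k - z k))\<^sup>2 \<le> energy 0"
    by linarith+
  have "0 < 2 * \<gamma> * s * (t_seq k)\<^sup>2" "0 < \<gamma> * (2 - s * L - \<gamma>) * (t_seq k)\<^sup>2"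
    using \<gamma> s t by simp_all
  with 1 2 show "gap (z k) \<le> energy 0 / (2 * \<gamma> * s) / (t_seq k)\<^sup>2"
    and "(norm (x k - z k))\<^sup>2 \<le> energy 0 / (\<gamma> * (2 - s * L - \<gamma>)) / (t_seq k)\<^sup>2"
    by (simp_all add: divide_divide_eq_left pos_le_divide_eq mult.commute[of _ "gap (z k)"]
        mult.commute[of _ "(norm (x k - z k))\<^sup>2"])
qed

lemma const_over_t_seq_square: "(\<lambda>k. c / (t_seq k)\<^sup>2) \<longlonglongrightarrow> 0"
  by (intro real_tendsto_divide_at_top[OF tendsto_const] filterlim_pow_at_top t_seq_at_top) simp

lemma gap_z_tendsto: "(\<lambda>k. gap (z k)) \<longlonglongrightarrow> 0"
  by (rule real_tendsto_sandwich[OF _ _ tendsto_const const_over_t_seq_square[of "energy 0 / (2 * \<gamma> * s)"]])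
    (intro always_eventually allI gap_nonneg F_z_finite gap_z_bound)+

lemma F_z_tendsto: "(\<lambda>k. F (z k)) \<longlonglongrightarrow> F w"
proof -
  have "(\<lambda>k. ereal (a + gap (z k))) \<longlonglongrightarrow> ereal (a + 0)"
    by (intro tendsto_intros gap_z_tendsto)
  then show ?thesis using F_eq_gap[OF F_z_finite] min_value by simp
qed

text \<open>Squeezed between the minimum and \<open>F (z k)\<close>, with the index shifted because
  \<open>y 0\<close> is arbitrary.\<close>

lemma F_y_tendsto: "(\<lambda>k. F (y k)) \<longlonglongrightarrow> F w"
proof (rule LIMSEQ_imp_Suc, rule tendsto_sandwich[OF _ _ tendsto_const F_z_tendsto])
qed (use F_ge min_value F_y_Suc_le in auto)

lemma residual_tendsto: "(\<lambda>k. x k - z k) \<longlonglongrightarrow> 0"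
proof -
  have "(\<lambda>k. (norm (x k - z k))\<^sup>2) \<longlonglongrightarrow> 0"
    by (rule real_tendsto_sandwich[OF _ _ tendsto_const const_over_t_seq_square[of "energy 0 / (\<gamma> * (2 - s * L - \<gamma>))"]])
      (intro always_eventually allI zero_le_power2 residual_bound)+
  then have "(\<lambda>k. sqrt ((norm (x k - z k))\<^sup>2)) \<longlonglongrightarrow> sqrt 0" by (rule tendsto_real_sqrt)
  then show ?thesis by (simp add: tendsto_norm_zero_iff)
qed

lemma weak_limit_points_subset_argmin:
  assumes "(\<lambda>k. F (X k)) \<longlonglongrightarrow> F w"
  shows "weak_limit_points X \<subseteq> argmin F"
proof
  fix l assume "l \<in> weak_limit_points X"
  then obtain r where r: "strict_mono r" "weakly_converges (X \<circ> r) l"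
    unfolding weak_limit_points_def by blast
  have "(\<lambda>n. F ((X \<circ> r) n)) \<longlonglongrightarrow> F w"
    using LIMSEQ_subseq_LIMSEQ[OF assms r(1)] by (simp add: o_def)
  moreover have "isCont f u" for u
    using f_smooth unfolding smooth_fun_def by (blast intro: differentiable_imp_continuous_within)
  ultimately show "l \<in> argmin F"
    using weak_limit_of_minimizing_sequence[OF convex_fun_composite[OF f_convex g_convex g_proper]
        proper_fun_composite[OF g_proper] lsc_fun_composite[OF _ g_lsc g_proper] minimizer r(2)]
    by blast
qed

text \<open>Extrapolation can leave the domain of \<open>g\<close>, so \<open>F (x k)\<close> may be
  infinite; \<open>x\<close> is handled through \<open>z\<close>, from which it differs by a
  strongly vanishing residual.\<close>

lemma weak_limit_points_x_subset: "weak_limit_points x \<subseteq> weak_limit_points z"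
proof
  fix l assume "l \<in> weak_limit_points x"
  then obtain r where r: "strict_mono r" "weakly_converges (x \<circ> r) l"
    unfolding weak_limit_points_def by blast
  have "(\<lambda>n. z (r n) \<bullet> h) \<longlonglongrightarrow> l \<bullet> h" for h
  proof -
    have "(\<lambda>n. x (r n) - z (r n)) \<longlonglongrightarrow> 0"
      using LIMSEQ_subseq_LIMSEQ[OF residual_tendsto r(1)] by (simp add: o_def)
    moreover have "(\<lambda>n. (x \<circ> r) n \<bullet> h) \<longlonglongrightarrow> l \<bullet> h"
      using r(2) unfolding weakly_converges_def by blast
    ultimately have "(\<lambda>n. (x \<circ> r) n \<bullet> h - (x (r n) - z (r n)) \<bullet> h) \<longlonglongrightarrow> l \<bullet> h - 0 \<bullet> h"
      by (intro tendsto_diff[OF _ tendsto_inner[OF _ tendsto_const]])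
    then show ?thesis by (simp add: inner_diff_left)
  qed
  then show "l \<in> weak_limit_points z"
    using r(1) unfolding weak_limit_points_def weakly_converges_def by auto
qed

end

theorem theorem5:
  fixes f :: "'a::{real_inner, complete_space} \<Rightarrow> real"
    and g :: "'a \<Rightarrow> ereal"
    and L s \<gamma> :: real
    and x y z :: "nat \<Rightarrow> 'a"
  assumes "L > 0"
    and "convex_on UNIV f" and "smooth_fun L f"
    and "convex_fun g" and "proper_fun g" and "lsc_fun g"
    and "argmin (composite f g) \<noteq> {}"
    and "s \<in> {0<..1 / L}"
    and "\<gamma> \<in> {0<..<2 - s * L}"
    and "m_apm f g s \<gamma> x y z"
  shows "weak_limit_points x \<subseteq> argmin (composite f g)
       \<and> weak_limit_points y \<subseteq> argmin (composite f g)
       \<and> weak_limit_points z \<subseteq> argmin (composite f g)"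
proof -
  obtain w where w: "w \<in> argmin (composite f g)" using assms(7) by blast
  obtain a where a: "composite f g w = ereal a"
    using proper_fun_composite[OF assms(5), of f] w unfolding proper_fun_def argmin_iff
    by (metis ereal_infty_less_eq(1) ereal_cases)
  interpret m_apm_run f g L s \<gamma> a x y z w
    by unfold_locales (use assms w a in auto)
  show ?thesis
    using weak_limit_points_subset_argmin[OF F_y_tendsto] weak_limit_points_subset_argmin[OF F_z_tendsto]
      weak_limit_points_x_subset by blast
qed

end
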